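(* Let $(N,A,c)$ be a public bads instance and let $x\in\Delta(A)$. The following are equivalent. (1) $c_i(x)>0$ for all $i\in N$ and $x$ is proportionally fair. (2) There exist personalized prices $p\in\mathbb{R}_{\ge0}^{N\times A}$ for which $(x,p)$ is a zero-respecting Lindahl equilibrium. (3) $c_i(x)>0$ for all $i\in N$ and $c(x)$ is a critical point in $\mathcal{C}_{\ge}$ of the Nash product $f_{\mathrm{Nash}}:\mathbb{R}^N_{\ge0}\to\mathbb{R}_{\ge0}$, $f_{\mathrm{Nash}}(y)=\prod_{i\in N}y_i$, i.e. $c(x)\in\Gamma(f_{\mathrm{Nash}},\mathcal{C}_{\ge})$.
   Context: A public bads instance $(N,A,c)$ consists of agents $N=\{1,\dots,n\}$, a finite set $A$ of alternatives (bads), and cost functions $c_i:A\to\mathbb{R}_{\ge 0}$, $i\in N$. $\Delta(A)$ is the set of lotteries (probability vectors) on $A$. Costs are extended linearly: $c_i(y)=\sum_{a\in A}y(a)c_i(a)$ for $y\in\mathbb{R}^A_{\ge0}$, and $c(y)=(c_i(y))_{i\in N}$. The cost set is $\mathcal{C}=\{c(x):x\in\Delta(A)\}$. Standing assumptions: $0\notin\mathcal{C}$, and for every $i\in N$ there is $a\in A$ with $c_i(a)<\max_{a'\in A}c_i(a')$. Proportional fairness (PF): $x\in\Delta(A)$ is PF if $\frac1n\sum_{i\in N}\frac{c_i(y)}{c_i(x)}\ge 1$ for all $y\in\Delta(A)$, with conventions $0/0=1$ and $\alpha/0=+\infty$ for $\alpha>0$. Lindahl equilibrium: a pair $(x,p)$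 with $x\in\Delta(A)$ and personalized prices $p=(p_i:A\to\mathbb{R}_{\ge0})_{i\in N}$ such that (i) $p_i\cdot x\ge 1/n$ for all $i\in N$; (ii) for every $i\in N$ and $y\in\mathbb{R}^A_{\ge0}$ with $p_i\cdot y\ge 1/n$ we have $c_i(y)\ge c_i(x)$, and moreover if $c_i(y)=c_i(x)=0$ then $\sum_{a\in A}y(a)\ge1$; (iii) $\sum_{i\in N}p_i(a)\ge1$ for every $a\in A$, with equality if $x(a)>0$. Here $p_i\cdot y=\sum_{a\in A}p_i(a)y(a)$. It is zero-respecting if for all $i\in N$, $a\in A$: $c_i(a)=0$ implies $p_i(a)=0$. Upward closure: $\mathcal{C}_{\ge}=\{z\in\mathbb{R}^N_{\ge0}:\exists z'\in\mathcal{C}\text{ with }z\ge z'\text{ coordinatewise}\}$. Critical points: for a smooth $f:\mathcal{X}\to\mathbb{R}$ and $\mathcal{Y}\subseteq\mathcal{X}$, $\Gamma(f,\mathcal{Y})$ is the set of $x\in\mathcal{Y}$ such that either $\nabla f(x)\cdot x\ge\nabla f(x)\cdot y$ for all $y\in\mathcal{Y}$, or $\nabla f(x)\cdot x\le\nabla f(x)\cdot y$ for all $y\in\mathcal{Y}$. *)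

theory Defs
  imports "HOL-Analysis.Analysis"
begin

text \<open>
  Agents and alternatives are the elements of finite types \<open>'n\<close> and \<open>'a\<close>, so
  \<open>n = CARD('n)\<close>.  A vector in $R^A$ is a \<open>real^'a\<close> and a cost profile is a \<open>real^'n\<close>.
\<close>

definition nonneg_orthant :: "(real^'k) set" where
  "nonneg_orthant = {y. \<forall>k. 0 \<le> y $ k}"

definition lotteries :: "(real^'a) set" where
  "lotteries = {x. (\<forall>a. 0 \<le> x $ a) \<and> (\<Sum>a\<in>UNIV. x $ a) = 1}"

definition cost :: "('n \<Rightarrow> 'a::finite \<Rightarrow> real) \<Rightarrow> 'n \<Rightarrow> real^'a \<Rightarrow> real" where
  "cost c i y = (\<Sum>a\<in>UNIV. y $ a * c i a)"

definition cost_profile :: "('n::finite \<Rightarrow> 'a::finite \<Rightarrow> real) \<Rightarrow> real^'a \<Rightarrow> real^'n" where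
  "cost_profile c y = (\<chi> i. cost c i y)"

definition cost_set :: "('n::finite \<Rightarrow> 'a::finite \<Rightarrow> real) \<Rightarrow> (real^'n) set" where
  "cost_set c = cost_profile c ` lotteries"

definition upward_cost_set :: "('n::finite \<Rightarrow> 'a::finite \<Rightarrow> real) \<Rightarrow> (real^'n) set" where
  "upward_cost_set c = {z \<in> nonneg_orthant. \<exists>z'\<in>cost_set c. \<forall>i. z' $ i \<le> z $ i}"

text \<open>The last two conjuncts are the standing assumptions on instances.\<close>

definition public_bads_instance :: "('n::finite \<Rightarrow> 'a::finite \<Rightarrow> real) \<Rightarrow> bool" where
  "public_bads_instance c \<longleftrightarrow>
     (\<forall>i a. 0 \<le> c i a) \<and>
     0 \<notin> cost_set c \<and>
     (\<forall>i. \<exists>a. c i a < Max (range (c i)))"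

text \<open>
  Quotient of nonnegative reals with the conventions $0/0 = 1$ and $r/0 = \infty$ for $r > 0$.
\<close>

definition cost_ratio :: "real \<Rightarrow> real \<Rightarrow> ereal" where
  "cost_ratio r s = (if s = 0 then (if r = 0 then 1 else \<infinity>) else ereal (r / s))"

definition proportionally_fair ::
    "('n::finite \<Rightarrow> 'a::finite \<Rightarrow> real) \<Rightarrow> real^'a \<Rightarrow> bool" where
  "proportionally_fair c x \<longleftrightarrow>
     x \<in> lotteries \<and>
     (\<forall>y\<in>lotteries.
        ereal (1 / real CARD('n)) * (\<Sum>i\<in>UNIV. cost_ratio (cost c i y) (cost c i x)) \<ge> 1)"

definition price :: "('n \<Rightarrow> 'a::finite \<Rightarrow> real) \<Rightarrow> 'n \<Rightarrow> real^'a \<Rightarrow> real" where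
  "price p i y = (\<Sum>a\<in>UNIV. p i a * y $ a)"

definition lindahl_equilibrium ::
    "('n::finite \<Rightarrow> 'a::finite \<Rightarrow> real) \<Rightarrow> real^'a \<Rightarrow> ('n \<Rightarrow> 'a \<Rightarrow> real) \<Rightarrow> bool" where
  "lindahl_equilibrium c x p \<longleftrightarrow>
     x \<in> lotteries \<and> (\<forall>i a. 0 \<le> p i a) \<and>
     (\<forall>i. price p i x \<ge> 1 / real CARD('n)) \<and>
     (\<forall>i. \<forall>y\<in>nonneg_orthant. price p i y \<ge> 1 / real CARD('n) \<longrightarrow>
        cost c i y \<ge> cost c i x \<and>
        (cost c i y = 0 \<and> cost c i x = 0 \<longrightarrow> (\<Sum>a\<in>UNIV. y $ a) \<ge> 1)) \<and>
     (\<forall>a. (\<Sum>i\<in>UNIV. p i a) \<ge> 1 \<and> (x $ a > 0 \<longrightarrow> (\<Sum>i\<in>UNIV. p i a) = 1))"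

definition zero_respecting ::
    "('n \<Rightarrow> 'a \<Rightarrow> real) \<Rightarrow> ('n \<Rightarrow> 'a \<Rightarrow> real) \<Rightarrow> bool" where
  "zero_respecting c p \<longleftrightarrow> (\<forall>i a. c i a = 0 \<longrightarrow> p i a = 0)"

text \<open>
  \<open>critical_points X f Y\<close> is $\Gamma(f, Y)$ for a smooth $f : X \to R$ and $Y \subseteq X$.
  The vector \<open>g\<close> is the gradient of \<open>f\<close> at \<open>x\<close>; derivatives are taken within the domain
  \<open>X\<close>, as only the values of \<open>f\<close> on \<open>X\<close> matter.  For \<open>X = nonneg_orthant\<close> the gradient is
  unique also at boundary points.
\<close>

definition critical_points ::
    "(real^'k) set \<Rightarrow> (real^'k \<Rightarrow> real) \<Rightarrow> (real^'k) set \<Rightarrow> (real^'k) set" where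
  "critical_points X f Y =
     {x \<in> Y. \<exists>g. (f has_derivative (\<lambda>h. g \<bullet> h)) (at x within X) \<and>
        ((\<forall>y\<in>Y. g \<bullet> x \<ge> g \<bullet> y) \<or> (\<forall>y\<in>Y. g \<bullet> x \<le> g \<bullet> y))}"

definition nash_product :: "real^'n \<Rightarrow> real" where
  "nash_product y = (\<Prod>i\<in>UNIV. y $ i)"

end

theory Submission
  imports Defs
begin

text \<open>
  All \<open>c\<^sub>i(x)\<close> are positive: in (2), an agent with $c_i(x) = 0$ would have
  $p_i \cdot x = 0$, as the prices are zero-respecting.  Each of the three conditions then says that
  $\sum_i c_i(a)/c_i(x) \ge n$ for every single alternative \<open>a\<close>.  For proportional fairness
  this is linearity in \<open>y\<close>.  For Lindahl equilibria, the prices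
  $p_i(a) = c_i(a)/(n\,c_i(x))$ work, and conversely condition (ii), applied to the multiple of
  \<open>a\<close> that costs exactly $1/n$ at the prices \<open>p\<^sub>i\<close>, bounds any equilibrium prices by these.
  For the Nash product, the gradient at \<open>c(x)\<close> is the positive multiple
  $f_{\mathrm{Nash}}(c(x))$ of $(1/c_i(x))_i$; as it is positive and the set is upward closed,
  \<open>c(x)\<close> can only be a minimizer of the linearization.
\<close>

section \<open>Point masses and linearity in the lottery\<close>

lemma cost_axis: "cost c i (axis a t) = t * c i a"
proof -
  have "cost c i (axis a t) = (\<Sum>b\<in>UNIV. if b = a then t * c i a else 0)"
    unfolding cost_def by (intro sum.cong) (auto simp: axis_def)
  then show ?thesis by simp
qed

lemma price_axis: "price p i (axis a t) = p i a * t"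
proof -
  have "price p i (axis a t) = (\<Sum>b\<in>UNIV. if b = a then p i a * t else 0)"
    unfolding price_def by (intro sum.cong) (auto simp: axis_def)
  then show ?thesis by simp
qed

lemma axis_in_lotteries: "axis a 1 \<in> lotteries"
proof -
  have "(\<Sum>b\<in>UNIV. (axis a 1 :: real^'a) $ b) = (\<Sum>b\<in>UNIV. if b = a then 1 else 0)"
    by (intro sum.cong) (auto simp: axis_def)
  then show ?thesis by (auto simp: lotteries_def axis_def)
qed

lemma sum_cost_ratio:
  fixes c :: "'n::finite \<Rightarrow> 'a::finite \<Rightarrow> real"
  shows "(\<Sum>i\<in>UNIV. cost c i y / w i) = (\<Sum>a\<in>UNIV. y $ a * (\<Sum>i\<in>UNIV. c i a / w i))"
proof -
  have "(\<Sum>i\<in>UNIV. cost c i y / w i) = (\<Sum>i\<in>UNIV. \<Sum>a\<in>UNIV. y $ a * (c i a / w i))"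
    by (simp add: cost_def sum_divide_distrib)
  also have "\<dots> = (\<Sum>a\<in>UNIV. \<Sum>i\<in>UNIV. y $ a * (c i a / w i))"
    by (rule sum.swap)
  finally show ?thesis by (simp add: sum_distrib_left)
qed

text \<open>Point masses are lotteries, which gives one direction. Conversely, weights that sum to 1
  preserve a common lower bound.\<close>

lemma lottery_average_ge_iff:
  "(\<forall>y\<in>lotteries. (\<Sum>a\<in>UNIV. y $ a * s a) \<ge> m) \<longleftrightarrow> (\<forall>a. s a \<ge> m)"
proof
  assume L: "\<forall>y\<in>lotteries. (\<Sum>a\<in>UNIV. y $ a * s a) \<ge> m"
  show "\<forall>a. s a \<ge> m"
  proof
    fix a
    \<comment> \<open>A dummy agent of type \<open>unit\<close> with costs \<open>s\<close> makes
      \<open>cost\<close> this weighted sum, so \<open>cost_axis\<close> applies.\<close>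
    have "(\<Sum>b\<in>UNIV. (axis a 1 :: real^'a) $ b * s b) = s a"
      using cost_axis[of "\<lambda>_::unit. s" "()" a 1] by (simp add: cost_def)
    then show "s a \<ge> m" using L axis_in_lotteries by metis
  qed
next
  assume R: "\<forall>a. s a \<ge> m"
  show "\<forall>y\<in>lotteries. (\<Sum>a\<in>UNIV. y $ a * s a) \<ge> m"
  proof
    fix y :: "real^'a" assume y: "y \<in> lotteries"
    have "m = (\<Sum>a\<in>UNIV. y $ a * m)"
      using y by (simp add: lotteries_def flip: sum_distrib_right)
    also have "\<dots> \<le> (\<Sum>a\<in>UNIV. y $ a * s a)"
      using y R by (intro sum_mono mult_left_mono) (auto simp: lotteries_def)
    finally show "(\<Sum>a\<in>UNIV. y $ a * s a) \<ge> m" .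
  qed
qed

lemma sum_cost_ratio_ge_iff:
  fixes c :: "'n::finite \<Rightarrow> 'a::finite \<Rightarrow> real"
  shows "(\<forall>y\<in>lotteries. (\<Sum>i\<in>UNIV. cost c i y / w i) \<ge> m) \<longleftrightarrow>
    (\<forall>a. (\<Sum>i\<in>UNIV. c i a / w i) \<ge> m)"
  unfolding sum_cost_ratio by (rule lottery_average_ge_iff)

text \<open>Positive costs at \<open>x\<close> switch off the division-by-zero conventions of
  \<open>cost_ratio\<close>, so the extended-real inequality becomes a real one, linear in
  \<open>y\<close>.\<close>

lemma proportionally_fair_iff:
  fixes c :: "'n::finite \<Rightarrow> 'a::finite \<Rightarrow> real"
  assumes "x \<in> lotteries" and pos: "\<And>i. cost c i x > 0"
  shows "proportionally_fair c x \<longleftrightarrow>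
    (\<forall>a. (\<Sum>i\<in>UNIV. c i a / cost c i x) \<ge> real CARD('n))"
proof -
  have "cost_ratio (cost c i y) (cost c i x) = ereal (cost c i y / cost c i x)" for i y
    using pos[of i] by (simp add: cost_ratio_def)
  then have "ereal (1 / real CARD('n)) * (\<Sum>i\<in>UNIV. cost_ratio (cost c i y) (cost c i x)) \<ge> 1
      \<longleftrightarrow> (\<Sum>i\<in>UNIV. cost c i y / cost c i x) \<ge> real CARD('n)" for y
    by (simp add: one_ereal_def pos_le_divide_eq)
  then show ?thesis
    using assms(1) by (simp add: proportionally_fair_def sum_cost_ratio_ge_iff)
qed

section \<open>Lindahl equilibria\<close>

text \<open>A sum of nonnegative terms vanishes only termwise, so at zero cost the lottery is
  supported where \<open>c i\<close> and hence \<open>p i\<close> is zero. This contradicts the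
  budget bound.\<close>

lemma lindahl_equilibrium_cost_pos:
  fixes c :: "'n::finite \<Rightarrow> 'a::finite \<Rightarrow> real"
  assumes nonneg: "\<And>i a. 0 \<le> c i a"
    and eq: "lindahl_equilibrium c x p" and zr: "zero_respecting c p"
  shows "cost c i x > 0"
proof (rule ccontr)
  assume "\<not> cost c i x > 0"
  have x: "\<And>a. 0 \<le> x $ a" using eq by (auto simp: lindahl_equilibrium_def lotteries_def)
  then have terms: "\<And>a. 0 \<le> x $ a * c i a" using nonneg by simp
  then have "cost c i x = 0"
    using \<open>\<not> cost c i x > 0\<close> sum_nonneg[of UNIV "\<lambda>a. x $ a * c i a"] terms
    by (simp add: cost_def order_less_le)
  then have "\<forall>a. x $ a * c i a = 0"
    using terms by (simp add: cost_def sum_nonneg_eq_0_iff)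
  then have "\<forall>a. p i a * x $ a = 0" using zr by (auto simp: zero_respecting_def)
  then have "price p i x = 0" unfolding price_def by (intro sum.neutral) blast
  moreover have "price p i x \<ge> 1 / real CARD('n)" using eq by (simp add: lindahl_equilibrium_def)
  moreover have "0 < 1 / real CARD('n)" by simp
  ultimately show False by linarith
qed

lemma lindahl_equilibrium_price_le:
  fixes c :: "'n::finite \<Rightarrow> 'a::finite \<Rightarrow> real"
  assumes nonneg: "\<And>i a. 0 \<le> c i a" and eq: "lindahl_equilibrium c x p"
    and pos: "cost c i x > 0"
  shows "real CARD('n) * p i a \<le> c i a / cost c i x"
proof (cases "p i a = 0")
  case True
  then show ?thesis using nonneg pos by simp
next
  case False
  then have p: "p i a > 0" using eq by (simp add: lindahl_equilibrium_def order_less_le)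
  \<comment> \<open>The scaling makes \<open>y\<close> meet the budget exactly. It need not be a
    lottery, since condition (ii) ranges over the whole orthant.\<close>
  define y where "y = axis a (1 / (real CARD('n) * p i a))"
  have "y \<in> nonneg_orthant" using p by (auto simp: y_def nonneg_orthant_def axis_def)
  moreover have "price p i y = 1 / real CARD('n)" using p by (simp add: y_def price_axis)
  ultimately have "cost c i x \<le> cost c i y" using eq by (simp add: lindahl_equilibrium_def)
  then show ?thesis using p pos by (simp add: y_def cost_axis field_simps)
qed

text \<open>Each agent's prices are proportional to the agent's own costs, so meeting the budget is
  the same as costing at least \<open>cost c i x\<close>. The equality in (iii) is complementary
  slackness.\<close>

lemma lindahl_equilibrium_proportional_prices:
  fixes c :: "'n::finite \<Rightarrow> 'a::finite \<Rightarrow> real"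
  assumes nonneg: "\<And>i a. 0 \<le> c i a" and x: "x \<in> lotteries"
    and pos: "\<And>i. cost c i x > 0"
    and ge: "\<And>a. (\<Sum>i\<in>UNIV. c i a / cost c i x) \<ge> real CARD('n)"
  shows "lindahl_equilibrium c x (\<lambda>i a. c i a / (real CARD('n) * cost c i x))"
    (is "lindahl_equilibrium c x ?p")
proof -
  let ?n = "real CARD('n)"
  have price: "price ?p i y = cost c i y / (?n * cost c i x)" for i y
    by (simp add: price_def cost_def sum_divide_distrib mult.commute)
  have budget: "price ?p i y \<ge> 1 / ?n \<longleftrightarrow> cost c i y \<ge> cost c i x" for i y
    using pos[of i] by (simp add: price field_simps)
  have sum_p: "(\<Sum>i\<in>UNIV. ?p i a) = (\<Sum>i\<in>UNIV. c i a / cost c i x) / ?n" for a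
    by (simp add: sum_divide_distrib mult.commute)
  have sum_p_ge: "(\<Sum>i\<in>UNIV. ?p i a) \<ge> 1" for a
    using ge[of a] by (simp add: sum_p pos_le_divide_eq)
  have tight: "(\<Sum>i\<in>UNIV. ?p i a) = 1" if "x $ a > 0" for a
  proof -
    \<comment> \<open>Under \<open>x\<close> itself each agent contributes the ratio 1. The
      nonnegative excesses over \<open>?n\<close> thus average to 0 and vanish on the support of
      \<open>x\<close>.\<close>
    have "(\<Sum>b\<in>UNIV. x $ b * (\<Sum>i\<in>UNIV. c i b / cost c i x)) = ?n"
      using pos by (simp add: less_imp_neq[symmetric] flip: sum_cost_ratio)
    then have "(\<Sum>b\<in>UNIV. x $ b * ((\<Sum>i\<in>UNIV. c i b / cost c i x) - ?n)) = 0"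
      using x by (simp add: right_diff_distrib sum_subtractf lotteries_def flip: sum_distrib_right)
    moreover have "0 \<le> x $ b * ((\<Sum>i\<in>UNIV. c i b / cost c i x) - ?n)" for b
      using x ge[of b] by (simp add: lotteries_def)
    ultimately have "x $ a * ((\<Sum>i\<in>UNIV. c i a / cost c i x) - ?n) = 0"
      by (simp add: sum_nonneg_eq_0_iff)
    then show ?thesis using that by (simp add: sum_p)
  qed
  \<comment> \<open>Rewriting with \<open>budget\<close> makes (i) and the cost comparison in (ii)
    tautologies; positivity makes the zero-cost clause vacuous.\<close>
  show ?thesis
    unfolding lindahl_equilibrium_def budget
    using x nonneg pos sum_p_ge tight by (auto simp: less_imp_le pos[THEN less_imp_neq, symmetric])
qed

lemma lindahl_equilibrium_zero_respecting_iff: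
  fixes c :: "'n::finite \<Rightarrow> 'a::finite \<Rightarrow> real"
  assumes nonneg: "\<And>i a. 0 \<le> c i a" and x: "x \<in> lotteries"
  shows "(\<exists>p. lindahl_equilibrium c x p \<and> zero_respecting c p) \<longleftrightarrow>
    (\<forall>i. cost c i x > 0) \<and> (\<forall>a. (\<Sum>i\<in>UNIV. c i a / cost c i x) \<ge> real CARD('n))"
proof
  assume "\<exists>p. lindahl_equilibrium c x p \<and> zero_respecting c p"
  then obtain p where eq: "lindahl_equilibrium c x p" and zr: "zero_respecting c p" by blast
  have pos: "cost c i x > 0" for i
    using lindahl_equilibrium_cost_pos[OF nonneg eq zr] .
  have "real CARD('n) \<le> (\<Sum>i\<in>UNIV. c i a / cost c i x)" for a
  proof -
    have "real CARD('n) * 1 \<le> real CARD('n) * (\<Sum>i\<in>UNIV. p i a)"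
      using eq by (intro mult_left_mono) (auto simp: lindahl_equilibrium_def)
    also have "\<dots> \<le> (\<Sum>i\<in>UNIV. c i a / cost c i x)"
      unfolding sum_distrib_left
      by (intro sum_mono lindahl_equilibrium_price_le[OF nonneg eq pos])
    finally show ?thesis by simp
  qed
  with pos show "(\<forall>i. cost c i x > 0) \<and>
    (\<forall>a. (\<Sum>i\<in>UNIV. c i a / cost c i x) \<ge> real CARD('n))" by blast
next
  assume "(\<forall>i. cost c i x > 0) \<and> (\<forall>a. (\<Sum>i\<in>UNIV. c i a / cost c i x) \<ge> real CARD('n))"
  then have "lindahl_equilibrium c x (\<lambda>i a. c i a / (real CARD('n) * cost c i x))"
    by (intro lindahl_equilibrium_proportional_prices nonneg x) auto
  moreover have "zero_respecting c (\<lambda>i a. c i a / (real CARD('n) * cost c i x))"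
    by (simp add: zero_respecting_def)
  ultimately show "\<exists>p. lindahl_equilibrium c x p \<and> zero_respecting c p" by blast
qed

section \<open>Critical points of the Nash product\<close>

lemma has_derivative_nash_product:
  fixes z :: "real^'n"
  assumes "\<And>i. z $ i \<noteq> 0"
  shows "(nash_product has_derivative (\<lambda>h. (\<chi> i. nash_product z / z $ i) \<bullet> h)) (at z within S)"
proof -
  have "((\<lambda>y. \<Prod>i\<in>UNIV. y $ i) has_derivative
      (\<lambda>h. \<Sum>i\<in>UNIV. h $ i * (\<Prod>j\<in>UNIV - {i}. z $ j))) (at z within S)"
    by (rule has_derivative_prod)
      (rule bounded_linear_imp_has_derivative[OF bounded_linear_vec_nth])
  moreover have "(\<Prod>j\<in>UNIV - {i}. z $ j) = nash_product z / z $ i" for i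
    using assms[of i] by (simp add: nash_product_def prod.remove[of UNIV i])
  ultimately show ?thesis
    by (simp add: inner_vec_def nash_product_def[abs_def] mult.commute)
qed

text \<open>Such points are interior, so derivatives within the orthant are ordinary ones and the
  gradient is unique.\<close>

lemma at_within_nonneg_orthant:
  fixes z :: "real^'n"
  assumes "\<And>i. z $ i > 0"
  shows "at z within nonneg_orthant = at z"
proof -
  have "open (\<Inter>i. {y :: real^'n. 0 < y $ i})"
    by (intro open_INT ballI open_Collect_less continuous_intros) simp
  then have "open {y :: real^'n. \<forall>i. 0 < y $ i}"
    by (simp add: Collect_all_eq)
  moreover have "{y :: real^'n. \<forall>i. 0 < y $ i} \<subseteq> nonneg_orthant"
    by (auto simp: nonneg_orthant_def less_imp_le)
  ultimately show ?thesis using assms by (intro at_within_interior interiorI) auto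
qed

lemma critical_point_nash_product_iff:
  fixes z :: "real^'n"
  assumes z: "\<And>i. z $ i > 0" and "z \<in> Y" and up: "\<And>y. (\<And>i. z $ i \<le> y $ i) \<Longrightarrow> y \<in> Y"
  shows "z \<in> critical_points nonneg_orthant nash_product Y \<longleftrightarrow>
    (\<forall>y\<in>Y. (\<Sum>i\<in>UNIV. y $ i / z $ i) \<ge> real CARD('n))"
proof -
  define g where "g = (\<chi> i. nash_product z / z $ i)"
  have P: "nash_product z > 0" using z by (auto simp: nash_product_def intro!: prod_pos)
  have nz: "z $ i \<noteq> 0" for i using z[of i] by simp
  have D: "(nash_product has_derivative (\<lambda>h. g \<bullet> h)) (at z)"
    unfolding g_def by (rule has_derivative_nash_product[OF nz])
  have grad: "(nash_product has_derivative (\<lambda>h. g' \<bullet> h)) (at z within nonneg_orthant) \<longleftrightarrow> g' = g" for g'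
  proof
    assume "(nash_product has_derivative (\<lambda>h. g' \<bullet> h)) (at z within nonneg_orthant)"
    then have "(\<lambda>h. g' \<bullet> h) = (\<lambda>h. g \<bullet> h)"
      using has_derivative_unique[OF _ D] by (simp add: at_within_nonneg_orthant[OF z])
    then show "g' = g" by (metis vector_eq_rdot)
  qed (simp add: at_within_nonneg_orthant[OF z] D)
  have gy: "g \<bullet> y = nash_product z * (\<Sum>i\<in>UNIV. y $ i / z $ i)" for y
    by (simp add: g_def inner_vec_def sum_distrib_left)
  have gz: "g \<bullet> z = nash_product z * real CARD('n)"
    using nz by (simp add: gy)
  \<comment> \<open>Doubling \<open>z\<close> stays above it, hence in \<open>Y\<close>, and doubles
    the positive value \<open>g \<bullet> z\<close>. This excludes the maximizing
    alternative.\<close>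
  define u where "u = 2 *\<^sub>R z"
  have "z $ i \<le> u $ i" for i using z[of i] by (simp add: u_def)
  then have "u \<in> Y" by (rule up)
  moreover have "g \<bullet> z < g \<bullet> u" using P by (simp add: u_def gz)
  ultimately have "\<not> (\<forall>y\<in>Y. g \<bullet> z \<ge> g \<bullet> y)" by (meson not_less)
  moreover have "g \<bullet> z \<le> g \<bullet> y \<longleftrightarrow> (\<Sum>i\<in>UNIV. y $ i / z $ i) \<ge> real CARD('n)" for y
    unfolding gz using P by (simp add: gy)
  ultimately show ?thesis
    using \<open>z \<in> Y\<close> by (auto simp: critical_points_def grad)
qed

text \<open>The weights \<open>1 / cost c i x\<close> are positive, so raising coordinates only
  raises the weighted sum: its lower bounds on the upward closure are those on the cost set.\<close>

lemma critical_point_cost_profile_iff: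
  fixes c :: "'n::finite \<Rightarrow> 'a::finite \<Rightarrow> real"
  assumes nonneg: "\<And>i a. 0 \<le> c i a" and x: "x \<in> lotteries" and pos: "\<And>i. cost c i x > 0"
  shows "cost_profile c x \<in> critical_points nonneg_orthant nash_product (upward_cost_set c) \<longleftrightarrow>
    (\<forall>a. (\<Sum>i\<in>UNIV. c i a / cost c i x) \<ge> real CARD('n))"
proof -
  have nth: "cost_profile c y $ i = cost c i y" for y i by (simp add: cost_profile_def)
  have profile: "cost_profile c y \<in> upward_cost_set c" if "y \<in> lotteries" for y
    using that nonneg
    by (auto simp: upward_cost_set_def cost_set_def nonneg_orthant_def nth cost_def lotteries_def
        intro!: sum_nonneg)
  have up: "y \<in> upward_cost_set c" if "\<And>i. cost_profile c x $ i \<le> y $ i" for y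
  proof -
    have "0 \<le> y $ i" for i using that[of i] pos[of i] unfolding nth by linarith
    then show ?thesis
      using that x by (auto simp: upward_cost_set_def cost_set_def nonneg_orthant_def)
  qed
  have "cost_profile c x \<in> critical_points nonneg_orthant nash_product (upward_cost_set c) \<longleftrightarrow>
    (\<forall>z\<in>upward_cost_set c. (\<Sum>i\<in>UNIV. z $ i / cost c i x) \<ge> real CARD('n))"
    using critical_point_nash_product_iff[of "cost_profile c x", OF _ profile[OF x] up] pos
    by (simp add: nth)
  also have "\<dots> \<longleftrightarrow> (\<forall>y\<in>lotteries. (\<Sum>i\<in>UNIV. cost c i y / cost c i x) \<ge> real CARD('n))"
  proof
    assume "\<forall>z\<in>upward_cost_set c. (\<Sum>i\<in>UNIV. z $ i / cost c i x) \<ge> real CARD('n)"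
    then show "\<forall>y\<in>lotteries. (\<Sum>i\<in>UNIV. cost c i y / cost c i x) \<ge> real CARD('n)"
      using profile by (force simp: nth)
  next
    assume L: "\<forall>y\<in>lotteries. (\<Sum>i\<in>UNIV. cost c i y / cost c i x) \<ge> real CARD('n)"
    show "\<forall>z\<in>upward_cost_set c. (\<Sum>i\<in>UNIV. z $ i / cost c i x) \<ge> real CARD('n)"
    proof
      fix z assume "z \<in> upward_cost_set c"
      then obtain y where y: "y \<in> lotteries" and le: "\<And>i. cost c i y \<le> z $ i"
        by (auto simp: upward_cost_set_def cost_set_def nth)
      have "real CARD('n) \<le> (\<Sum>i\<in>UNIV. cost c i y / cost c i x)" using L y by blast
      also have "\<dots> \<le> (\<Sum>i\<in>UNIV. z $ i / cost c i x)"
        using le pos by (intro sum_mono divide_right_mono) (auto simp: less_imp_le)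
      finally show "(\<Sum>i\<in>UNIV. z $ i / cost c i x) \<ge> real CARD('n)" .
    qed
  qed
  finally show ?thesis by (simp add: sum_cost_ratio_ge_iff)
qed

theorem theorem4p9:
  fixes c :: "'n::finite \<Rightarrow> 'a::finite \<Rightarrow> real" and x :: "real^'a"
  assumes "public_bads_instance c" and "x \<in> lotteries"
  shows "((\<forall>i. cost c i x > 0) \<and> proportionally_fair c x
           \<longleftrightarrow> (\<exists>p. lindahl_equilibrium c x p \<and> zero_respecting c p))
       \<and> ((\<exists>p. lindahl_equilibrium c x p \<and> zero_respecting c p)
           \<longleftrightarrow> (\<forall>i. cost c i x > 0) \<and>
               cost_profile c x \<in> critical_points nonneg_orthant nash_product (upward_cost_set c))"
proof -
  have nonneg: "\<And>i a. 0 \<le> c i a" using assms(1) by (simp add: public_bads_instance_def)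
  show ?thesis
    \<comment> \<open>The bound on ratio sums over all alternatives links the three conditions; the
      last two facts take their positivity premise from the conjuncts.\<close>
    using lindahl_equilibrium_zero_respecting_iff[of c, OF nonneg assms(2)]
      proportionally_fair_iff[OF assms(2), of c]
      critical_point_cost_profile_iff[of c, OF nonneg assms(2)]
    by blast
qed

end
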